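(* Let $k\ge2$. Let $F_1,\dots,F_R$ be Sidorenko graphs, each with at least one edge, let $\eta_1,\dots,\eta_R\in\mathbb R_{\ge0}^k$, $\delta_1,\dots,\delta_R\ge0$, and $c_1\in\mathbb R^k$, and for $\mathbf W\in\mathcal W_k$ set $$T(\mathbf W)=t(K_2,\langle c_1,\mathbf W\rangle)-\sum_{s=1}^R\delta_s\,t(F_s,\langle\eta_s,\mathbf W\rangle).$$ Let $\psi_n=\frac1{n^2}\log\sum_{\mathscr X\in\mathcal C_n^k}\exp\{n^2T(\mathbf W^{\mathscr X})\}$. Then $$\lim_{n\to\infty}\psi_n=\sup_{\mu\in\Delta_k}\Big(\langle c_1,\mu\rangle-\sum_{s=1}^R\delta_s\langle\eta_s,\mu\rangle^{|E(F_s)|}-\tfrac12I_k(\mu)\Big),\qquad I_k(\mu)=\sum_{a=1}^k\mu_a\log\mu_a.$$ Moreover, every maximizer of $\mathbf W\mapsto T(\mathbf W)-\frac12\mathcal I(\mathbf W)$ over $k$-colored probability graphons is (almost everywhere) a constant graphon $\mathbf W\equiv\mu^*$, where $\mu^*\in\Delta_k$ attains the supremum on the right-hand side above.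
   Context: A graphon is a measurable symmetric $W:[0,1]^2\to[0,1]$. For a finite simple graph $H$ and a bounded symmetric measurable $U:[0,1]^2\to\mathbb R$, $$t(H,U)=\int_{[0,1]^{V(H)}}\prod_{(u,v)\in E(H)}U(x_u,x_v)\prod_{v\in V(H)}dx_v ;$$ $K_2$ is a single edge. A finite simple graph $H$ is a Sidorenko graph if $t(H,W)\ge t(K_2,W)^{|E(H)|}$ for every graphon $W$. Let $[k]=\{1,\dots,k\}$ and $\Delta_k=\{\mu\in[0,1]^k:\sum_a\mu_a=1\}$. A $k$-colored probability graphon is a measurable symmetric map $\mathbf W=(W_1,\dots,W_k):[0,1]^2\to\Delta_k$; $\mathcal W_k$ is the set of these. For $\alpha\in\mathbb R^k$, $\langle\alpha,\mathbf W\rangle(x,y)=\sum_{a=1}^k\alpha_aW_a(x,y)$, and $\langle\alpha,\mu\rangle$ is the usual inner product. $\mathcal C_n^k$ is the set of all maps $\mathscr X$ from the edge set of the complete graph $K_n$ on $\{1,\dots,n\}$ to $[k]$. The empirical graphon $\mathbf W^{\mathscr X}\in\mathcal W_k$ has $W^{\mathscr X}_a(x,y)=\mathbf 1\{\mathscr X(\{u,v\})=a\}$ for $(x,y)\in(\frac{u-1}n,\frac un]\times(\frac{v-1}n,\frac vn]$, $u\ne v$, and $\mathbf W^{\mathscr X}=(\frac1k,\dots,\frac1k)$ on the diagonal blocks $u=v$. $\mathcal I(\mathbf W)=\int_{[0,1]^2}I_k(\mathbf W(x,y))\,dx\,dy$, with $0\log 0=0$. *)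

theory Defs
  imports "HOL-Analysis.Analysis"
begin

record 'v sgraph =
  verts :: "'v set"
  edges :: "'v set set"

definition simple_graph :: "('v, 'b) sgraph_scheme \<Rightarrow> bool" where
  "simple_graph H \<longleftrightarrow> finite (verts H) \<and> (\<forall>e\<in>edges H. e \<subseteq> verts H \<and> card e = 2)"

definition K2 :: "nat sgraph" where
  "K2 = \<lparr>verts = {0, 1}, edges = {{0, 1}}\<rparr>"

text \<open>The unit interval carries the Borel sets and Lebesgue measure. Functions on the unit square
  are total functions on pairs of reals, of which only the values on the square matter.\<close>

definition unit_interval :: "real measure" where
  "unit_interval = restrict_space lborel {0..1}"

definition unit_square :: "(real \<times> real) measure" where
  "unit_square = unit_interval \<Otimes>\<^sub>M unit_interval"

text \<open>The vertices are linearly ordered only in order to write an edge \<open>{u, v}\<close> as the pair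
  \<open>(Min e, Max e)\<close>; for symmetric \<open>U\<close> the orientation of the edges is irrelevant.\<close>

definition hom_density :: "'v::linorder sgraph \<Rightarrow> (real \<times> real \<Rightarrow> real) \<Rightarrow> real" where
  "hom_density H U =
     (\<integral>x. (\<Prod>e\<in>edges H. U (x (Min e), x (Max e))) \<partial>(\<Pi>\<^sub>M v\<in>verts H. unit_interval))"

definition graphon :: "(real \<times> real \<Rightarrow> real) \<Rightarrow> bool" where
  "graphon W \<longleftrightarrow> W \<in> borel_measurable unit_square \<and>
     (\<forall>x\<in>{0..1}. \<forall>y\<in>{0..1}. W (x, y) \<in> {0..1} \<and> W (x, y) = W (y, x))"

definition sidorenko_graph :: "'v::linorder sgraph \<Rightarrow> bool" where
  "sidorenko_graph H \<longleftrightarrow> simple_graph H \<and>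
     (\<forall>W. graphon W \<longrightarrow> hom_density H W \<ge> hom_density K2 W ^ card (edges H))"

text \<open>The set of \<open>k\<close> colours is a finite type \<open>'k\<close> with \<open>k = CARD('k)\<close>.\<close>

definition prob_simplex :: "(real ^ 'k) set" where
  "prob_simplex = {\<mu>. (\<forall>a. \<mu> $ a \<in> {0..1}) \<and> (\<Sum>a\<in>UNIV. \<mu> $ a) = 1}"

definition colored_graphons :: "(real \<times> real \<Rightarrow> real ^ 'k) set" where
  "colored_graphons = {W. W \<in> borel_measurable unit_square \<and>
     (\<forall>x\<in>{0..1}. \<forall>y\<in>{0..1}. W (x, y) \<in> prob_simplex \<and> W (x, y) = W (y, x))}"

definition colorings :: "nat \<Rightarrow> (nat set \<Rightarrow> 'k) set" where
  "colorings n = {e. e \<subseteq> {1..n} \<and> card e = 2} \<rightarrow>\<^sub>E UNIV"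

text \<open>For \<open>n \<ge> 1\<close> and \<open>x \<in> {0<..1}\<close>, \<open>block n x\<close> is the unique \<open>u\<close> with
  \<open>x \<in> {(u - 1) / n<..u / n}\<close>. The point \<open>0\<close>, which lies in none of these intervals,
  is put into the first one.\<close>

definition block :: "nat \<Rightarrow> real \<Rightarrow> nat" where
  "block n x = max 1 (nat \<lceil>real n * x\<rceil>)"

definition empirical_graphon :: "nat \<Rightarrow> (nat set \<Rightarrow> 'k) \<Rightarrow> real \<times> real \<Rightarrow> real ^ 'k" where
  "empirical_graphon n X = (\<lambda>(x, y).
     if block n x \<noteq> block n y
     then (\<chi> a. if X {block n x, block n y} = a then 1 else 0)
     else (\<chi> a. 1 / real CARD('k)))"

text \<open>The convention \<open>0 log 0 = 0\<close> holds automatically.\<close>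

definition neg_entropy :: "real ^ 'k \<Rightarrow> real" where
  "neg_entropy \<mu> = (\<Sum>a\<in>UNIV. \<mu> $ a * ln (\<mu> $ a))"

definition graphon_neg_entropy :: "(real \<times> real \<Rightarrow> real ^ 'k) \<Rightarrow> real" where
  "graphon_neg_entropy W = (\<integral>z. neg_entropy (W z) \<partial>unit_square)"

definition T_functional ::
  "nat \<Rightarrow> (nat \<Rightarrow> 'v::linorder sgraph) \<Rightarrow> (nat \<Rightarrow> real ^ 'k) \<Rightarrow> (nat \<Rightarrow> real) \<Rightarrow> real ^ 'k
    \<Rightarrow> (real \<times> real \<Rightarrow> real ^ 'k) \<Rightarrow> real" where
  "T_functional R F \<eta> \<delta> c W =
     hom_density K2 (\<lambda>z. c \<bullet> W z) - (\<Sum>s=1..R. \<delta> s * hom_density (F s) (\<lambda>z. \<eta> s \<bullet> W z))"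

definition free_energy :: "((real \<times> real \<Rightarrow> real ^ 'k) \<Rightarrow> real) \<Rightarrow> nat \<Rightarrow> real" where
  "free_energy T n =
     1 / (real n)\<^sup>2 * ln (\<Sum>X\<in>colorings n. exp ((real n)\<^sup>2 * T (empirical_graphon n X)))"

definition scalar_objective ::
  "nat \<Rightarrow> (nat \<Rightarrow> 'v sgraph) \<Rightarrow> (nat \<Rightarrow> real ^ 'k) \<Rightarrow> (nat \<Rightarrow> real) \<Rightarrow> real ^ 'k
    \<Rightarrow> real ^ 'k \<Rightarrow> real" where
  "scalar_objective R F \<eta> \<delta> c \<mu> =
     c \<bullet> \<mu> - (\<Sum>s=1..R. \<delta> s * (\<eta> s \<bullet> \<mu>) ^ card (edges (F s))) - 1 / 2 * neg_entropy \<mu>"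

end

theory Submission
  imports Defs "HOL-Probability.Infinite_Product_Measure" "HOL-Real_Asymp.Real_Asymp"
begin

text \<open>
  By the Sidorenko property \<open>T W\<close> is at most its value at the constant graphon \<open>m\<close>, the mean of \<open>W\<close>.
  A maximizer must therefore have equality in Jensen's inequality for the entropy, so it equals \<open>m\<close>
  almost everywhere.

  No large deviation principle is needed for the limit. Upper bound: under independent edge colours
  of law \<open>m\<close>, every colouring whose empirical graphon has mean \<open>m\<close> has probability at least
  \<open>exp (n\<^sup>2 / 2 * neg_entropy m)\<close>, which bounds the number of such colourings; and only polynomially
  many means occur. Lower bound: by the Gibbs variational principle the logarithm of the partition
  function is at least the expected energy plus the entropy of an independent colouring of law
  \<open>\<mu>\<close>, and the expected homomorphism densities converge to those of the constant graphon \<open>\<mu>\<close>.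
\<close>

section \<open>Elementary inequalities for the logarithm and a double count of edges\<close>

text \<open>The relative entropy of \<open>p\<close> with respect to the Gibbs law
  \<open>exp (f x) / Z\<close> is nonnegative. Pointwise this is \<open>ln y \<le> y - 1\<close> at
  \<open>y = exp (f x) / (p x * Z)\<close>, multiplied by \<open>p x\<close>.\<close>

lemma gibbs_variational:
  fixes p f :: "'a \<Rightarrow> real"
  assumes fin: "finite A" and p: "\<And>x. x \<in> A \<Longrightarrow> 0 \<le> p x" "sum p A = 1"
  shows "(\<Sum>x\<in>A. p x * f x - p x * ln (p x)) \<le> ln (\<Sum>x\<in>A. exp (f x))"
proof -
  define Z where "Z = (\<Sum>x\<in>A. exp (f x))"
  have "A \<noteq> {}" using p(2) by auto
  then have Z: "Z > 0" unfolding Z_def using fin by (intro sum_pos) auto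
  \<comment> \<open>After summation the first two terms on the right cancel, since both laws have
    total mass 1, and \<open>ln Z\<close> remains.\<close>
  have "p x * f x - p x * ln (p x) \<le> exp (f x) / Z - p x + p x * ln Z" if "x \<in> A" for x
  proof (cases "p x = 0")
    case True
    then show ?thesis using Z by simp
  next
    case False
    then have px: "p x > 0" using p(1)[OF that] by simp
    have "ln (exp (f x) / (p x * Z)) \<le> exp (f x) / (p x * Z) - 1"
      using px Z by (intro ln_le_minus_one) simp
    also have "ln (exp (f x) / (p x * Z)) = f x - ln (p x) - ln Z"
      using px Z by (simp add: ln_div ln_mult)
    finally have "p x * (f x - ln (p x) - ln Z) \<le> p x * (exp (f x) / (p x * Z) - 1)"
      using px by (intro mult_left_mono) auto
    also have "\<dots> = exp (f x) / Z - p x" using px by (simp add: field_simps)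
    finally show ?thesis by (simp add: algebra_simps)
  qed
  then have "(\<Sum>x\<in>A. p x * f x - p x * ln (p x)) \<le> (\<Sum>x\<in>A. exp (f x) / Z - p x + p x * ln Z)"
    by (rule sum_mono)
  also have "\<dots> = (\<Sum>x\<in>A. exp (f x)) / Z - sum p A + sum p A * ln Z"
    by (simp add: sum.distrib sum_subtractf sum_divide_distrib sum_distrib_right)
  also have "\<dots> = ln Z" using Z p(2) by (simp add: Z_def[symmetric])
  finally show ?thesis unfolding Z_def .
qed

text \<open>The linear part \<open>- w + m\<close> makes each single colour contribute a nonnegative
  amount; it disappears on integration when \<open>m\<close> is the mean of \<open>w\<close>. The
  third assumption is absolute continuity: for \<open>m = 0\<close> and small \<open>w > 0\<close>
  the default \<open>ln 0 = 0\<close> would make the expression negative.\<close>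

lemma relative_entropy_term:
  fixes w m :: real
  assumes "0 \<le> w" "0 \<le> m" "m = 0 \<Longrightarrow> w = 0"
  shows "0 \<le> w * ln w - w * ln m - w + m"
    and "w * ln w - w * ln m - w + m = 0 \<Longrightarrow> w = m"
proof -
  have "0 \<le> w * ln w - w * ln m - w + m \<and> (w * ln w - w * ln m - w + m = 0 \<longrightarrow> w = m)"
  proof (cases "w = 0")
    case True
    then show ?thesis using assms by auto
  next
    case False
    then have w: "w > 0" and m: "m > 0" using assms by force+
    \<comment> \<open>In terms of \<open>r = m / w\<close> the bracket is
      \<open>r - 1 - ln r\<close>, so sign and equality case are those of the tangent to the
      logarithm at 1.\<close>
    have *: "w * ln w - w * ln m - w + m = w * (m / w - 1 - ln (m / w))"
      using w m by (simp add: ln_div field_simps)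
    have "ln (m / w) \<le> m / w - 1" using w m by (intro ln_le_minus_one) simp
    moreover have "m / w = 1" if "ln (m / w) = m / w - 1"
      using that w m by (intro ln_eq_minus_one) auto
    ultimately show ?thesis using w unfolding * by auto
  qed
  then show "0 \<le> w * ln w - w * ln m - w + m"
    and "w * ln w - w * ln m - w + m = 0 \<Longrightarrow> w = m" by auto
qed

text \<open>Every two-element set arises from exactly two ordered pairs. This converts sums over the
  off-diagonal blocks of the square into sums over edges.\<close>

lemma sum_ordered_pairs:
  fixes G :: "'a set \<Rightarrow> real"
  assumes "finite A"
  shows "(\<Sum>u\<in>A. \<Sum>v\<in>A. if u \<noteq> v then G {u, v} else 0) = 2 * (\<Sum>e | e \<subseteq> A \<and> card e = 2. G e)"
proof -
  define S where "S = {z \<in> A \<times> A. fst z \<noteq> snd z}"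
  let ?P = "{e. e \<subseteq> A \<and> card e = 2}"
  have finS: "finite S" and finP: "finite ?P" using assms by (auto simp: S_def)
  have "(\<Sum>u\<in>A. \<Sum>v\<in>A. if u \<noteq> v then G {u, v} else 0)
      = (\<Sum>z\<in>A \<times> A. if fst z \<noteq> snd z then G {fst z, snd z} else 0)"
    by (simp add: sum.cartesian_product split_def)
  also have "\<dots> = (\<Sum>z\<in>S. G {fst z, snd z})"
    unfolding S_def using assms by (simp add: sum.inter_filter)
  also have "\<dots> = (\<Sum>e\<in>?P. \<Sum>z | z \<in> S \<and> {fst z, snd z} = e. G {fst z, snd z})"
    using finS finP by (intro sum.group[symmetric]) (auto simp: S_def)
  also have "\<dots> = (\<Sum>e\<in>?P. 2 * G e)"
  proof (intro sum.cong refl)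
    fix e assume "e \<in> ?P"
    then obtain a b where ab: "e = {a, b}" "a \<noteq> b" "a \<in> A" "b \<in> A"
      by (auto simp: card_2_iff)
    then have "{z. z \<in> S \<and> {fst z, snd z} = e} = {(a, b), (b, a)}"
      by (auto simp: S_def doubleton_eq_iff)
    then show "(\<Sum>z | z \<in> S \<and> {fst z, snd z} = e. G {fst z, snd z}) = 2 * G e"
      using ab by (simp add: insert_commute)
  qed
  finally show ?thesis by (simp add: sum_distrib_left)
qed

section \<open>The unit interval and the unit square as probability spaces\<close>

lemma space_unit_interval [simp]: "space unit_interval = {0..1}"
  by (simp add: unit_interval_def space_restrict_space)

lemma space_unit_square [simp]: "space unit_square = {0..1} \<times> {0..1}"
  by (simp add: unit_square_def space_pair_measure)

lemma prob_space_unit_interval: "prob_space unit_interval"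
  by (rule prob_spaceI) (simp add: unit_interval_def space_restrict_space emeasure_restrict_space)

interpretation U: prob_space unit_interval
  by (rule prob_space_unit_interval)

interpretation UU: pair_prob_space unit_interval unit_interval ..

interpretation PU: product_sigma_finite "\<lambda>_. unit_interval"
  by unfold_locales

lemma prob_space_unit_square: "prob_space unit_square"
  unfolding unit_square_def by (rule UU.prob_space_axioms)

interpretation US: prob_space unit_square
  by (rule prob_space_unit_square)

section \<open>Blocks and integrals of step functions\<close>

lemma block_bounds:
  assumes "n \<ge> 1" "x \<in> {0..1}"
  shows "block n x \<in> {1..n}"
proof -
  have "\<lceil>real n * x\<rceil> \<le> int n"
    using assms by (intro ceiling_le) (auto intro: mult_left_le)
  then show ?thesis using assms by (auto simp: block_def)
qed

text \<open>The disjunct \<open>u = 1\<close> reflects the \<open>max 1\<close> in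
  \<open>block\<close>, which puts the point 0 into the first block; the other blocks are half-open
  intervals.\<close>

lemma block_eq_iff:
  assumes "n \<ge> 1" "x \<in> {0..1}" "u \<ge> 1"
  shows "block n x = u \<longleftrightarrow> (u = 1 \<or> (real u - 1) / real n < x) \<and> x \<le> real u / real n"
proof -
  have n: "real n > 0" using assms by simp
  have *: "nat \<lceil>real n * x\<rceil> = u \<longleftrightarrow> real u - 1 < real n * x \<and> real n * x \<le> real u"
    using assms(3) by (auto simp: ceiling_eq_iff nat_eq_iff2) linarith+
  show ?thesis
  proof (cases "u = 1")
    case True
    have "block n x = 1 \<longleftrightarrow> nat \<lceil>real n * x\<rceil> \<le> 1"
      unfolding block_def by (metis max.absorb_iff1)
    also have "\<dots> \<longleftrightarrow> real n * x \<le> 1"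
      by (simp only: nat_le_iff ceiling_le_iff) simp
    finally show ?thesis using True n by (simp add: field_simps)
  next
    case False
    then have "block n x = u \<longleftrightarrow> nat \<lceil>real n * x\<rceil> = u" using assms(3) by (auto simp: block_def)
    then show ?thesis unfolding * using False n by (simp add: field_simps)
  qed
qed

lemma block_eq_imp_close:
  assumes "n \<ge> 1" "x \<in> {0..1}" "y \<in> {0..1}" "block n x = block n y"
  shows "\<bar>x - y\<bar> \<le> 1 / real n"
proof -
  have u: "block n x \<ge> 1" using block_bounds[OF assms(1,2)] by simp
  have lo: "(real (block n x) - 1) / real n \<le> z \<and> z \<le> real (block n x) / real n"
    if "z \<in> {0..1}" "block n z = block n x" for z
    using block_eq_iff[OF assms(1) that(1) u] that by auto
  have "(real (block n x) - 1) / real n = real (block n x) / real n - 1 / real n"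
    by (simp add: diff_divide_distrib)
  then show ?thesis using lo[OF assms(2) refl] lo[OF assms(3) assms(4)[symmetric]] by linarith
qed

lemma measurable_block [measurable]: "block n \<in> unit_interval \<rightarrow>\<^sub>M count_space UNIV"
proof -
  have "block n \<in> borel \<rightarrow>\<^sub>M count_space UNIV" unfolding block_def by measurable
  then show ?thesis unfolding unit_interval_def
    by (intro measurable_restrict_space1) simp
qed

lemma measure_block:
  assumes "n \<ge> 1" "u \<in> {1..n}"
  shows "measure unit_interval {x \<in> {0..1}. block n x = u} = 1 / real n"
proof -
  let ?S = "{x \<in> {0..1}. block n x = u}"
  have n: "real n > 0" using assms by simp
  have un: "real u / real n \<le> 1" "0 \<le> (real u - 1) / real n" using assms n by (auto simp: field_simps)
  have S: "?S = (if u = 1 then {0..real u / real n} else {(real u - 1) / real n <.. real u / real n})"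
    (is "_ = ?T")
  proof (intro set_eqI)
    fix x
    have "x \<in> {0..1}" if "x \<in> ?T"
      using that un by (auto split: if_splits)
    then show "x \<in> ?S \<longleftrightarrow> x \<in> ?T"
      using block_eq_iff[OF assms(1), of x u] assms(2) by (auto split: if_splits)
  qed
  have "measure unit_interval ?S = measure lborel ?S"
    unfolding unit_interval_def by (rule measure_restrict_space) auto
  also have "\<dots> = 1 / real n"
    unfolding S using n by (auto simp: diff_divide_distrib divide_right_mono)
  finally show ?thesis .
qed

text \<open>A function of the block index is a finite combination of block indicators, and each
  block has measure \<open>1 / real n\<close>.\<close>

lemma integral_block:
  fixes f :: "nat \<Rightarrow> real"
  assumes "n \<ge> 1"
  shows "(\<integral>x. f (block n x) \<partial>unit_interval) = (\<Sum>u\<in>{1..n}. f u) / real n"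
proof -
  have "(\<integral>x. f (block n x) \<partial>unit_interval)
      = (\<integral>x. (\<Sum>u\<in>{1..n}. f u * indicator {x \<in> {0..1}. block n x = u} x) \<partial>unit_interval)"
  proof (rule Bochner_Integration.integral_cong[OF refl])
    fix x assume "x \<in> space unit_interval"
    then have x: "x \<in> {0..1}" by simp
    have "(\<Sum>u\<in>{1..n}. f u * indicator {x \<in> {0..1}. block n x = u} x)
        = (\<Sum>u\<in>{1..n}. if u = block n x then f u else 0)"
      using x by (intro sum.cong) (auto simp: indicator_def)
    also have "\<dots> = f (block n x)"
      using block_bounds[OF assms x] by (simp add: sum.delta)
    finally show "f (block n x) = (\<Sum>u\<in>{1..n}. f u * indicator {x \<in> {0..1}. block n x = u} x)" ..
  qed
  also have "\<dots> = (\<Sum>u\<in>{1..n}. f u * measure unit_interval {x \<in> {0..1}. block n x = u})"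
  proof (subst Bochner_Integration.integral_sum)
    fix u
    have [measurable]: "{x \<in> {0..1}. block n x = u} \<in> sets unit_interval"
    proof -
      have "{x \<in> space unit_interval. block n x = u} \<in> sets unit_interval" by measurable
      then show ?thesis by simp
    qed
    show "integrable unit_interval (\<lambda>x. f u * indicator {x \<in> {0..1}. block n x = u} x)"
      by (intro integrable_mult_right integrable_real_indicator)
         (simp_all only: \<open>_ \<in> sets unit_interval\<close> U.emeasure_eq_measure ennreal_less_top
          infinity_ennreal_def)
  qed (auto simp: Int_def conj_commute intro!: sum.cong arg_cong[where f="measure unit_interval"])
  also have "\<dots> = (\<Sum>u\<in>{1..n}. f u * (1 / real n))"
    by (intro sum.cong refl) (simp only: measure_block[OF assms])
  finally show ?thesis by (simp add: sum_divide_distrib)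
qed

text \<open>A product of countable discrete spaces is discrete, so every function of the pair of
  blocks becomes measurable.\<close>

lemma measurable_block_pair:
  "(\<lambda>z. (block n (fst z), block n (snd z))) \<in> unit_square \<rightarrow>\<^sub>M count_space UNIV"
proof -
  have "(\<lambda>z. (block n (fst z), block n (snd z)))
      \<in> unit_square \<rightarrow>\<^sub>M (count_space UNIV \<Otimes>\<^sub>M count_space UNIV)"
    unfolding unit_square_def by measurable
  then show ?thesis by (simp add: pair_measure_countable)
qed

lemma integral_block_pair:
  fixes G :: "nat \<Rightarrow> nat \<Rightarrow> real"
  assumes "n \<ge> 1"
  shows "(\<integral>z. G (block n (fst z)) (block n (snd z)) \<partial>unit_square)
      = (\<Sum>u\<in>{1..n}. \<Sum>v\<in>{1..n}. G u v) / (real n)\<^sup>2"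
proof -
  let ?f = "\<lambda>z. G (block n (fst z)) (block n (snd z))"
  have meas: "?f \<in> borel_measurable unit_square"
    using measurable_compose[OF measurable_block_pair, of "case_prod G" borel n] by simp
  \<comment> \<open>The sum of all absolute values is a crude bound; it gives the integrability that
    Fubini requires.\<close>
  have "integrable unit_square ?f"
  proof (rule US.integrable_const_bound[where B = "\<Sum>u\<in>{1..n}. \<Sum>v\<in>{1..n}. \<bar>G u v\<bar>"])
    show "AE z in unit_square. norm (?f z) \<le> (\<Sum>u\<in>{1..n}. \<Sum>v\<in>{1..n}. \<bar>G u v\<bar>)"
    proof (rule AE_I2)
      fix z assume "z \<in> space unit_square"
      then have b: "block n (fst z) \<in> {1..n}" "block n (snd z) \<in> {1..n}"
        using block_bounds[OF assms] by auto
      have "\<bar>?f z\<bar> \<le> (\<Sum>v\<in>{1..n}. \<bar>G (block n (fst z)) v\<bar>)"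
        using b(2) by (intro member_le_sum) auto
      also have "\<dots> \<le> (\<Sum>u\<in>{1..n}. \<Sum>v\<in>{1..n}. \<bar>G u v\<bar>)"
        using b(1) by (intro member_le_sum[where f = "\<lambda>u. \<Sum>v\<in>{1..n}. \<bar>G u v\<bar>"] sum_nonneg) auto
      finally show "norm (?f z) \<le> (\<Sum>u\<in>{1..n}. \<Sum>v\<in>{1..n}. \<bar>G u v\<bar>)" by simp
    qed
  qed (rule meas)
  then have "integral\<^sup>L unit_square ?f
      = (\<integral>x. (\<integral>y. G (block n x) (block n y) \<partial>unit_interval) \<partial>unit_interval)"
    unfolding unit_square_def by (subst UU.integral_fst'[symmetric]) auto
  also have "\<dots> = (\<integral>x. (\<lambda>u. (\<Sum>v\<in>{1..n}. G u v) / real n) (block n x) \<partial>unit_interval)"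
    by (simp add: integral_block[OF assms])
  also have "\<dots> = (\<Sum>u\<in>{1..n}. (\<Sum>v\<in>{1..n}. G u v) / real n) / real n"
    by (rule integral_block[OF assms])
  finally show ?thesis by (simp add: sum_divide_distrib power2_eq_square)
qed


section \<open>Pairs of coordinates in the product space\<close>

text \<open>Two different coordinates are independent and uniform. It suffices to compare the
  measures on rectangles. Integrals and null sets can then be moved between the square and the
  product over all vertices.\<close>

lemma distr_pair_PiM:
  assumes V: "finite V" "u \<in> V" "v \<in> V" "u \<noteq> v"
  shows "distr (\<Pi>\<^sub>M i\<in>V. unit_interval) unit_square (\<lambda>x. (x u, x v)) = unit_square"
proof -
  let ?P = "\<Pi>\<^sub>M i\<in>V. unit_interval"
  have m: "(\<lambda>x. (x u, x v)) \<in> ?P \<rightarrow>\<^sub>M (unit_interval \<Otimes>\<^sub>M unit_interval)"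
    using V by measurable
  have "unit_interval \<Otimes>\<^sub>M unit_interval = distr ?P unit_square (\<lambda>x. (x u, x v))"
  proof (rule pair_measure_eqI)
    fix A B assume AB: "A \<in> sets unit_interval" "B \<in> sets unit_interval"
    \<comment> \<open>The preimage of the rectangle is the box with these sides; all sides other
      than those at \<open>u\<close> and \<open>v\<close> have measure 1.\<close>
    let ?E = "\<lambda>i. if i = u then A else if i = v then B else space unit_interval"
    have "A \<subseteq> {0..1}" "B \<subseteq> {0..1}" using sets.sets_into_space[OF AB(1)] sets.sets_into_space[OF AB(2)] by auto
    then have eq: "(\<lambda>x. (x u, x v)) -` (A \<times> B) \<inter> space ?P = Pi\<^sub>E V ?E"
    proof (intro set_eqI iffI)
      fix x assume "x \<in> Pi\<^sub>E V ?E"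
      then have ext: "x \<in> extensional V" and mem: "\<And>i. i \<in> V \<Longrightarrow> x i \<in> ?E i"
        by (auto simp: PiE_iff)
      have "x u \<in> A" "x v \<in> B" using mem[OF V(2)] mem[OF V(3)] V(4) by auto
      moreover have "x i \<in> {0..1}" if "i \<in> V" for i
        using mem[OF that] \<open>A \<subseteq> _\<close> \<open>B \<subseteq> _\<close> unfolding space_unit_interval
        by (metis subsetD)
      ultimately show "x \<in> (\<lambda>x. (x u, x v)) -` (A \<times> B) \<inter> space ?P"
        using ext by (simp add: space_PiM PiE_iff)
    qed (use V in \<open>auto simp: space_PiM PiE_iff split: if_splits\<close>)
    have "emeasure (distr ?P unit_square (\<lambda>x. (x u, x v))) (A \<times> B) = emeasure ?P (Pi\<^sub>E V ?E)"
      unfolding eq[symmetric] unit_square_def using m AB by (intro emeasure_distr) auto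
    also have "\<dots> = (\<Prod>i\<in>V. emeasure unit_interval (?E i))"
      using V AB by (intro PU.emeasure_PiM) (auto simp del: space_unit_interval)
    also have "\<dots> = (\<Prod>i\<in>{u, v}. emeasure unit_interval (?E i))"
      using V by (intro prod.mono_neutral_right) (auto simp: U.emeasure_space_1[simplified])
    finally show "emeasure unit_interval A * emeasure unit_interval B
        = emeasure (distr ?P unit_square (\<lambda>x. (x u, x v))) (A \<times> B)"
      using V by simp
  qed (auto simp: unit_square_def intro: U.sigma_finite_measure_axioms)
  then show ?thesis by (simp add: unit_square_def)
qed

lemma AE_unit_interval_neq: "AE y in unit_interval. y \<noteq> a"
  unfolding unit_interval_def
  by (subst AE_restrict_space_iff) (use AE_lborel_singleton[of a] in auto)

text \<open>Each section of the diagonal is a single point, hence a null set.\<close>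

lemma AE_unit_square_neq: "AE z in unit_square. fst z \<noteq> snd z"
  unfolding unit_square_def
proof (rule UU.AE_pair_measure)
  have "fst \<in> borel_measurable (unit_interval \<Otimes>\<^sub>M unit_interval)"
    "snd \<in> borel_measurable (unit_interval \<Otimes>\<^sub>M unit_interval)"
    using measurable_compose[OF measurable_fst, of "\<lambda>x. x" unit_interval borel]
      measurable_compose[OF measurable_snd, of "\<lambda>x. x" unit_interval borel]
    by (auto simp: unit_interval_def measurable_restrict_space1)
  then show "{z \<in> space (unit_interval \<Otimes>\<^sub>M unit_interval). fst z \<noteq> snd z}
      \<in> sets (unit_interval \<Otimes>\<^sub>M unit_interval)" by measurable
qed (use AE_unit_interval_neq in \<open>auto simp: eq_commute\<close>)

text \<open>A coincidence of two coordinates is the preimage of the diagonal under a pair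
  projection, and there are finitely many such pairs.\<close>

lemma AE_PiM_inj_on:
  assumes V: "finite V"
  shows "AE x in (\<Pi>\<^sub>M i\<in>V. unit_interval). inj_on x V"
proof -
  let ?P = "\<Pi>\<^sub>M i\<in>V. unit_interval"
  have "AE x in ?P. u \<noteq> v \<longrightarrow> x u \<noteq> x v" if "u \<in> V" "v \<in> V" for u v
  proof (cases "u = v")
    case False
    have "(\<lambda>x. (x u, x v)) \<in> ?P \<rightarrow>\<^sub>M unit_square"
      unfolding unit_square_def using that by measurable
    moreover have "AE z in distr ?P unit_square (\<lambda>x. (x u, x v)). fst z \<noteq> snd z"
      unfolding distr_pair_PiM[OF V that False] by (rule AE_unit_square_neq)
    ultimately show ?thesis by (auto dest: AE_distrD)
  qed simp
  then have "AE x in ?P. \<forall>u\<in>V. \<forall>v\<in>V. u \<noteq> v \<longrightarrow> x u \<noteq> x v"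
    using V by (intro AE_finite_allI) auto
  then show ?thesis by eventually_elim (auto simp: inj_on_def)
qed

section \<open>Basic properties of homomorphism densities\<close>

lemma simple_graph_edge:
  assumes "simple_graph H" "e \<in> edges H"
  shows "Min e \<in> verts H" "Max e \<in> verts H" "{Min e, Max e} = e" "Min e \<noteq> Max e"
proof -
  have e: "e \<subseteq> verts H" "card e = 2" using assms by (auto simp: simple_graph_def)
  then obtain a b where ab: "e = {a, b}" "a \<noteq> b" by (auto simp: card_2_iff)
  then have "{Min e, Max e} = e \<and> Min e \<noteq> Max e"
    by (cases "a \<le> b") (auto simp: min_def max_def)
  then show "{Min e, Max e} = e" "Min e \<noteq> Max e" by auto
  then show "Min e \<in> verts H" "Max e \<in> verts H" using e by auto
qed

lemma measurable_edge_product: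
  fixes H :: "'v::linorder sgraph"
  assumes "simple_graph H" "U \<in> borel_measurable unit_square"
  shows "(\<lambda>x. \<Prod>e\<in>edges H. U (x (Min e), x (Max e)) :: real)
    \<in> borel_measurable (\<Pi>\<^sub>M v\<in>verts H. unit_interval)"
proof (rule borel_measurable_prod)
  fix e assume "e \<in> edges H"
  then have "(\<lambda>x. (x (Min e), x (Max e))) \<in> (\<Pi>\<^sub>M v\<in>verts H. unit_interval) \<rightarrow>\<^sub>M unit_square"
    unfolding unit_square_def using simple_graph_edge[OF assms(1)] by measurable
  from measurable_compose[OF this assms(2)]
  show "(\<lambda>x. U (x (Min e), x (Max e))) \<in> borel_measurable (\<Pi>\<^sub>M v\<in>verts H. unit_interval)" .
qed

lemma simple_graph_K2: "simple_graph K2"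
  by (simp add: simple_graph_def K2_def)

lemma hom_density_K2:
  assumes "U \<in> borel_measurable unit_square"
  shows "hom_density K2 U = integral\<^sup>L unit_square U"
proof -
  let ?P = "\<Pi>\<^sub>M v\<in>{0, 1::nat}. unit_interval"
  have m: "(\<lambda>x. (x 0, x 1)) \<in> ?P \<rightarrow>\<^sub>M unit_square"
    unfolding unit_square_def by measurable
  have "hom_density K2 U = (\<integral>x. U (x 0, x 1) \<partial>?P)"
    by (simp add: hom_density_def K2_def)
  also have "\<dots> = integral\<^sup>L (distr ?P unit_square (\<lambda>x. (x 0, x 1))) U"
    by (rule integral_distr[symmetric, OF m assms])
  also have "\<dots> = integral\<^sup>L unit_square U"
    by (subst distr_pair_PiM) auto
  finally show ?thesis .
qed

lemma prob_space_PiM_unit_interval: "prob_space (\<Pi>\<^sub>M v\<in>V. unit_interval)"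
  by (rule prob_space_PiM) (rule prob_space_unit_interval)

lemma hom_density_const: "hom_density H (\<lambda>z. c) = c ^ card (edges H)"
proof -
  interpret prob_space "\<Pi>\<^sub>M v\<in>verts H. unit_interval" by (rule prob_space_PiM_unit_interval)
  show ?thesis by (simp add: hom_density_def prob_space)
qed

text \<open>This homogeneity permits rescaling a bounded nonnegative kernel to values in the unit
  interval, where the Sidorenko property applies.\<close>

lemma hom_density_scale:
  "hom_density H (\<lambda>z. r * U z) = r ^ card (edges H) * hom_density H U"
  by (simp add: hom_density_def prod.distrib)

section \<open>The probability simplex and means of coloured graphons\<close>

lemma prob_simplexD:
  assumes "\<mu> \<in> prob_simplex"
  shows "0 \<le> \<mu> $ a" "\<mu> $ a \<le> 1" "(\<Sum>a\<in>UNIV. \<mu> $ a) = 1"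
  using assms by (auto simp: prob_simplex_def)

lemma norm_prob_simplex_le: "\<mu> \<in> prob_simplex \<Longrightarrow> norm \<mu> \<le> 1"
  using norm_le_l1_cart[of \<mu>] by (simp add: prob_simplexD)

lemma colored_graphon_measurable: "W \<in> colored_graphons \<Longrightarrow> W \<in> borel_measurable unit_square"
  by (simp add: colored_graphons_def)

lemma colored_graphon_simplex:
  "W \<in> colored_graphons \<Longrightarrow> z \<in> space unit_square \<Longrightarrow> W z \<in> prob_simplex"
  by (auto simp: colored_graphons_def)

lemma integrable_colored_graphon:
  assumes "W \<in> colored_graphons"
  shows "integrable unit_square W"
  using assms by (intro US.integrable_const_bound[where B=1])
    (auto intro!: AE_I2 norm_prob_simplex_le dest: colored_graphon_simplex
      simp: colored_graphon_measurable simp del: space_unit_square)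

lemma integrable_colored_graphon_nth:
  assumes "W \<in> colored_graphons"
  shows "integrable unit_square (\<lambda>z. W z $ a)"
    and "(\<integral>z. W z $ a \<partial>unit_square) = (integral\<^sup>L unit_square W) $ a"
  using integrable_colored_graphon[OF assms] bounded_linear_vec_nth[of a]
  by (auto intro: integrable_bounded_linear integral_bounded_linear)

lemma mean_in_prob_simplex:
  assumes "W \<in> colored_graphons"
  shows "integral\<^sup>L unit_square W \<in> prob_simplex"
proof -
  note W = colored_graphon_simplex[OF assms]
  note I = integrable_colored_graphon_nth[OF assms]
  have "0 \<le> (integral\<^sup>L unit_square W) $ a" for a
    unfolding I(2)[symmetric] by (intro integral_nonneg_AE AE_I2 prob_simplexD(1) W)
  moreover have "(integral\<^sup>L unit_square W) $ a \<le> 1" for a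
    unfolding I(2)[symmetric]
    using I(1) by (intro US.integral_le_const AE_I2 prob_simplexD(2) W)
  moreover have "(\<Sum>a\<in>UNIV. (integral\<^sup>L unit_square W) $ a) = 1"
  proof -
    have "(\<Sum>a\<in>UNIV. (integral\<^sup>L unit_square W) $ a) = (\<integral>z. (\<Sum>a\<in>UNIV. W z $ a) \<partial>unit_square)"
      using I by simp
    also have "\<dots> = (\<integral>z. 1 \<partial>unit_square)"
      by (intro Bochner_Integration.integral_cong refl prob_simplexD(3) W)
    finally show ?thesis by (simp add: US.prob_space del: space_unit_square)
  qed
  ultimately show ?thesis by (simp add: prob_simplex_def)
qed

lemma abs_inner_prob_simplex_le:
  assumes "\<mu> \<in> prob_simplex"
  shows "\<bar>v \<bullet> \<mu>\<bar> \<le> (\<Sum>a\<in>UNIV. \<bar>v $ a\<bar>)"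
proof -
  have "\<bar>v \<bullet> \<mu>\<bar> \<le> (\<Sum>a\<in>UNIV. \<bar>v $ a * \<mu> $ a\<bar>)"
    unfolding inner_vec_def by (simp add: sum_abs)
  also have "\<dots> \<le> (\<Sum>a\<in>UNIV. \<bar>v $ a\<bar>)"
    using assms by (intro sum_mono) (auto simp: abs_mult prob_simplexD intro: mult_left_le)
  finally show ?thesis .
qed

lemma inner_nonneg_prob_simplex:
  "(\<And>a. v $ a \<ge> 0) \<Longrightarrow> \<mu> \<in> prob_simplex \<Longrightarrow> 0 \<le> v \<bullet> \<mu>"
  by (auto simp: inner_vec_def prob_simplexD intro!: sum_nonneg)

section \<open>The Sidorenko bound and the reduction to constant graphons\<close>

text \<open>The kernel \<open>\<eta> \<bullet> W z\<close> lies between 0 and the sum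
  \<open>M\<close> of the coefficients. Dividing by \<open>M\<close> gives a graphon, and both sides
  of its Sidorenko inequality scale by the same power of \<open>M\<close>. The edge density is an
  integral, so it only sees the mean of \<open>W\<close>.\<close>

lemma sidorenko_colored:
  assumes H: "sidorenko_graph H" "card (edges H) \<ge> 1"
    and W: "W \<in> colored_graphons" and \<eta>: "\<And>a. \<eta> $ a \<ge> 0"
  shows "(\<eta> \<bullet> integral\<^sup>L unit_square W) ^ card (edges H) \<le> hom_density H (\<lambda>z. \<eta> \<bullet> W z)"
proof -
  define M where "M = (\<Sum>a\<in>UNIV. \<bar>\<eta> $ a\<bar>)"
  show ?thesis
  proof (cases "M = 0")
    \<comment> \<open>Division by \<open>M\<close> is impossible here, but then the kernel vanishes
      and the two sides coincide.\<close>
    case True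
    then have "\<eta> = 0" by (auto simp: M_def sum_nonneg_eq_0_iff vec_eq_iff)
    then show ?thesis using hom_density_const[of H 0] by simp
  next
    case False
    then have M: "M > 0" by (simp add: M_def less_le sum_nonneg)
    let ?U = "\<lambda>z. \<eta> \<bullet> W z / M"
    have meas: "?U \<in> borel_measurable unit_square"
      using colored_graphon_measurable[OF W] by measurable
    have "graphon ?U"
      unfolding graphon_def
    proof (intro conjI meas ballI)
      fix x y :: real assume xy: "x \<in> {0..1}" "y \<in> {0..1}"
      then have s: "W (x, y) \<in> prob_simplex" "W (x, y) = W (y, x)"
        using W by (auto simp: colored_graphons_def)
      show "?U (x, y) \<in> {0..1}"
        using abs_inner_prob_simplex_le[OF s(1), of \<eta>] inner_nonneg_prob_simplex[OF \<eta> s(1)] M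
        by (simp add: M_def[symmetric])
      show "?U (x, y) = ?U (y, x)" using s(2) by simp
    qed
    then have "hom_density K2 ?U ^ card (edges H) \<le> hom_density H ?U"
      using H(1) by (simp add: sidorenko_graph_def)
    then have "M ^ card (edges H) * hom_density K2 ?U ^ card (edges H)
        \<le> M ^ card (edges H) * hom_density H ?U"
      using M by (intro mult_left_mono) auto
    also have "\<dots> = hom_density H (\<lambda>z. \<eta> \<bullet> W z)"
      using hom_density_scale[of H M ?U] M by simp
    also have "hom_density K2 ?U = (\<eta> \<bullet> integral\<^sup>L unit_square W) / M"
      using hom_density_K2[OF meas] integrable_colored_graphon[OF W] by simp
    finally show ?thesis using M by (simp add: power_divide)
  qed
qed


text \<open>The \<open>K2\<close> term is linear in \<open>W\<close> and depends on the mean alone;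
  the other densities enter with coefficients \<open>- \<delta> s \<le> 0\<close>, so replacing
  \<open>W\<close> by its mean can only increase \<open>T\<close>. The added half of
  \<open>neg_entropy\<close> cancels the entropy inside \<open>scalar_objective\<close>.\<close>

lemma T_functional_le_scalar:
  assumes F: "\<And>s. s \<in> {1..R} \<Longrightarrow> sidorenko_graph (F s)"
      "\<And>s. s \<in> {1..R} \<Longrightarrow> card (edges (F s)) \<ge> 1"
    and \<eta>: "\<And>s a. s \<in> {1..R} \<Longrightarrow> \<eta> s $ a \<ge> 0"
    and \<delta>: "\<And>s. s \<in> {1..R} \<Longrightarrow> \<delta> s \<ge> 0"
    and W: "W \<in> colored_graphons"
  defines "\<mu> \<equiv> integral\<^sup>L unit_square W"
  shows "T_functional R F \<eta> \<delta> c W \<le> scalar_objective R F \<eta> \<delta> c \<mu> + 1 / 2 * neg_entropy \<mu>"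
proof -
  have [measurable]: "W \<in> borel_measurable unit_square"
    by (rule colored_graphon_measurable[OF W])
  have "hom_density K2 (\<lambda>z. c \<bullet> W z) = c \<bullet> \<mu>"
    using integrable_colored_graphon[OF W] by (subst hom_density_K2) (auto simp: \<mu>_def)
  moreover have "(\<Sum>s=1..R. \<delta> s * (\<eta> s \<bullet> \<mu>) ^ card (edges (F s)))
      \<le> (\<Sum>s=1..R. \<delta> s * hom_density (F s) (\<lambda>z. \<eta> s \<bullet> W z))"
    unfolding \<mu>_def using F \<eta> \<delta> W by (intro sum_mono mult_left_mono sidorenko_colored) auto
  ultimately show ?thesis by (simp add: T_functional_def scalar_objective_def)
qed

lemma T_functional_const:
  "T_functional R F \<eta> \<delta> c (\<lambda>z. \<mu>) = scalar_objective R F \<eta> \<delta> c \<mu> + 1 / 2 * neg_entropy \<mu>"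
  using hom_density_const[of K2 "c \<bullet> \<mu>"]
  by (simp add: T_functional_def scalar_objective_def hom_density_const K2_def)

lemma graphon_neg_entropy_const: "graphon_neg_entropy (\<lambda>z. \<mu>) = neg_entropy \<mu>"
  by (simp add: graphon_neg_entropy_def US.prob_space del: space_unit_square)

lemma const_in_colored_graphons: "\<mu> \<in> prob_simplex \<Longrightarrow> (\<lambda>z. \<mu>) \<in> colored_graphons"
  by (simp add: colored_graphons_def)

section \<open>Entropy bounds and the equality case of Jensen's inequality\<close>

lemma neg_entropy_term_bounds:
  fixes t :: real
  assumes "0 \<le> t" "t \<le> 1"
  shows "- 1 \<le> t * ln t" "t * ln t \<le> 0"
proof -
  \<comment> \<open>At \<open>m = 1\<close> the relative entropy term reads
    \<open>t * ln t - t + 1\<close>, whence \<open>t * ln t \<ge> t - 1 \<ge> - 1\<close>.\<close>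
  show "- 1 \<le> t * ln t"
    using relative_entropy_term(1)[of t 1] assms by simp
  show "t * ln t \<le> 0"
    using assms by (cases "t = 0") (auto intro: mult_nonneg_nonpos)
qed

lemma neg_entropy_bounds:
  fixes \<mu> :: "real ^ 'k"
  assumes "\<mu> \<in> prob_simplex"
  shows "- real CARD('k) \<le> neg_entropy \<mu>" "neg_entropy \<mu> \<le> 0"
proof -
  have "(\<Sum>a\<in>(UNIV::'k set). - 1) \<le> neg_entropy \<mu>"
    unfolding neg_entropy_def using assms by (intro sum_mono neg_entropy_term_bounds prob_simplexD)
  then show "- real CARD('k) \<le> neg_entropy \<mu>" by simp
  show "neg_entropy \<mu> \<le> 0"
    unfolding neg_entropy_def using assms by (intro sum_nonpos neg_entropy_term_bounds prob_simplexD)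
qed

text \<open>A supremum of reals is meaningful only for a set bounded above. The subtracted sum is
  nonnegative, and the linear and entropy terms are bounded on the simplex.\<close>

lemma bdd_above_scalar_objective:
  assumes "\<And>s a. s \<in> {1..R} \<Longrightarrow> \<eta> s $ a \<ge> 0" "\<And>s. s \<in> {1..R} \<Longrightarrow> \<delta> s \<ge> 0"
  shows "bdd_above (scalar_objective R F \<eta> \<delta> (c :: real ^ 'k) ` prob_simplex)"
proof (rule bdd_aboveI2)
  fix \<mu> :: "real ^ 'k" assume \<mu>: "\<mu> \<in> prob_simplex"
  have "0 \<le> (\<Sum>s=1..R. \<delta> s * (\<eta> s \<bullet> \<mu>) ^ card (edges (F s)))"
    using assms \<mu> by (intro sum_nonneg mult_nonneg_nonneg zero_le_power inner_nonneg_prob_simplex)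
  then show "scalar_objective R F \<eta> \<delta> c \<mu> \<le> (\<Sum>a\<in>UNIV. \<bar>c $ a\<bar>) + real CARD('k)"
    using abs_inner_prob_simplex_le[OF \<mu>, of c] neg_entropy_bounds[OF \<mu>]
    unfolding scalar_objective_def by linarith
qed

text \<open>Where \<open>m $ a = 0\<close> the graphon component \<open>W z $ a\<close> vanishes almost everywhere, so the integrand
  below is nonnegative although \<open>ln 0\<close> is a junk value.\<close>

lemma jensen_neg_entropy_eq:
  fixes W :: "real \<times> real \<Rightarrow> real ^ 'k"
  assumes W: "W \<in> colored_graphons"
  defines "m \<equiv> integral\<^sup>L unit_square W"
  assumes le: "graphon_neg_entropy W \<le> neg_entropy m"
  shows "AE z in unit_square. W z = m"
proof -
  have [measurable]: "W \<in> borel_measurable unit_square"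
    by (rule colored_graphon_measurable[OF W])
  have [measurable]: "(\<lambda>z. W z $ a) \<in> borel_measurable unit_square" for a
    using integrable_colored_graphon_nth(1)[OF W] by (rule borel_measurable_integrable)
  note s = colored_graphon_simplex[OF W]
  note I = integrable_colored_graphon_nth[OF W, folded m_def]
  have m: "m \<in> prob_simplex" unfolding m_def by (rule mean_in_prob_simplex[OF W])
  let ?\<phi> = "\<lambda>a z. W z $ a * ln (W z $ a) - W z $ a * ln (m $ a) - W z $ a + m $ a"
  have J: "integrable unit_square (\<lambda>z. W z $ a * ln (W z $ a))" for a
  proof (rule US.integrable_const_bound[where B=1])
    show "AE z in unit_square. norm (W z $ a * ln (W z $ a)) \<le> 1"
      by (intro AE_I2)
        (use neg_entropy_term_bounds[OF prob_simplexD(1,2)[OF s]] in \<open>force simp: abs_le_iff\<close>)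
  qed measurable
  have \<phi>: "integrable unit_square (?\<phi> a)" for a
    using I(1)[of a] J[of a] by simp
  \<comment> \<open>The mean of \<open>W z $ a\<close> is \<open>m $ a\<close>, so the linear terms
    integrate to zero and the entropy difference remains.\<close>
  have int\<phi>: "integral\<^sup>L unit_square (?\<phi> a)
      = (\<integral>z. W z $ a * ln (W z $ a) \<partial>unit_square) - m $ a * ln (m $ a)" for a
    using I[of a] J[of a] by (simp add: US.prob_space del: space_unit_square)
  have nonneg: "AE z in unit_square. 0 \<le> ?\<phi> a z \<and> (?\<phi> a z = 0 \<longrightarrow> W z $ a = m $ a)" for a
  proof (cases "m $ a = 0")
    case True
    have "AE z in unit_square. 0 \<le> W z $ a"
      by (intro AE_I2 prob_simplexD(1) s)
    then have "AE z in unit_square. W z $ a = 0"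
      using integral_nonneg_eq_0_iff_AE[OF I(1)[of a]] I(2)[of a] True by simp
    then show ?thesis by eventually_elim (simp add: True)
  next
    case False
    then show ?thesis
      using relative_entropy_term[of "W _ $ a" "m $ a"] prob_simplexD(1)[OF m, of a]
        prob_simplexD(1)[OF s, of _ a] by (intro AE_I2) auto
  qed
  have nn: "AE z in unit_square. \<forall>a. 0 \<le> ?\<phi> a z \<and> (?\<phi> a z = 0 \<longrightarrow> W z $ a = m $ a)"
    using AE_finite_allI[OF finite_class.finite_UNIV nonneg] by simp
  then have nn': "AE z in unit_square. 0 \<le> (\<Sum>a\<in>UNIV. ?\<phi> a z)"
    by eventually_elim (auto intro!: sum_nonneg)
  \<comment> \<open>The assumption \<open>le\<close> makes this integral nonpositive while its
    integrand is nonnegative almost everywhere. Hence each summand vanishes almost everywhere, which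
    is the equality case.\<close>
  have "(\<integral>z. (\<Sum>a\<in>UNIV. ?\<phi> a z) \<partial>unit_square) = graphon_neg_entropy W - neg_entropy m"
    using \<phi> int\<phi> J by (simp add: graphon_neg_entropy_def neg_entropy_def sum_subtractf)
  moreover have "0 \<le> (\<integral>z. (\<Sum>a\<in>UNIV. ?\<phi> a z) \<partial>unit_square)"
    using nn' by (rule integral_nonneg_AE)
  ultimately have "(\<integral>z. (\<Sum>a\<in>UNIV. ?\<phi> a z) \<partial>unit_square) = 0" using le by linarith
  then have "AE z in unit_square. (\<Sum>a\<in>UNIV. ?\<phi> a z) = 0"
    using integral_nonneg_eq_0_iff_AE[OF _ nn'] \<phi> by simp
  with nn show ?thesis
  proof eventually_elim
    case (elim z)
    then have "\<forall>a\<in>UNIV. ?\<phi> a z = 0"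
      by (subst sum_nonneg_eq_0_iff[symmetric]) auto
    then show ?case using elim(1) by (simp add: vec_eq_iff)
  qed
qed


section \<open>Colourings with independent edge colours\<close>

abbreviation pairs :: "nat \<Rightarrow> nat set set" where
  "pairs n \<equiv> {e. e \<subseteq> {1..n} \<and> card e = 2}"

text \<open>The probability of \<open>X\<close> when the edges of the complete graph receive
  independent colours of law \<open>\<mu>\<close>.\<close>

definition coloring_weight :: "real ^ 'k \<Rightarrow> nat \<Rightarrow> (nat set \<Rightarrow> 'k) \<Rightarrow> real" where
  "coloring_weight \<mu> n X = (\<Prod>e\<in>pairs n. \<mu> $ X e)"

lemma finite_colorings [simp]: "finite (colorings n :: (nat set \<Rightarrow> 'k::finite) set)"
  unfolding colorings_def by (intro finite_PiE) auto

lemma coloring_weight_nonneg: "\<mu> \<in> prob_simplex \<Longrightarrow> 0 \<le> coloring_weight \<mu> n X"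
  unfolding coloring_weight_def by (intro prod_nonneg) (auto simp: prob_simplexD)

text \<open>Independence in the form of the distributive law: the sum over colourings factors over
  edges, an edge in \<open>D\<close> giving the expectation \<open>v \<bullet> \<mu>\<close> and any
  other edge the total mass 1. The empty set gives normalization and a singleton gives the marginal
  law.\<close>

lemma sum_coloring_weight_prod:
  fixes \<mu> v :: "real ^ 'k"
  assumes \<mu>: "\<mu> \<in> prob_simplex" and D: "D \<subseteq> pairs n"
  shows "(\<Sum>X\<in>colorings n. coloring_weight \<mu> n X * (\<Prod>d\<in>D. v $ X d)) = (v \<bullet> \<mu>) ^ card D"
proof -
  have restrict: "(\<Prod>d\<in>D. f d) = (\<Prod>d\<in>pairs n. if d \<in> D then f d else 1)" for f :: "nat set \<Rightarrow> real"
    using prod.inter_restrict[of "pairs n" f D] D by (simp add: Int_absorb1)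
  have "(\<Sum>X\<in>colorings n. coloring_weight \<mu> n X * (\<Prod>d\<in>D. v $ X d))
      = (\<Sum>X\<in>colorings n. \<Prod>e\<in>pairs n. \<mu> $ X e * (if e \<in> D then v $ X e else 1))"
    unfolding coloring_weight_def restrict by (simp add: prod.distrib)
  also have "\<dots> = (\<Prod>e\<in>pairs n. \<Sum>a\<in>UNIV. \<mu> $ a * (if e \<in> D then v $ a else 1))"
    unfolding colorings_def
    by (rule prod_sum_PiE[symmetric, where f = "\<lambda>e a. \<mu> $ a * (if e \<in> D then v $ a else 1)"]) auto
  also have "\<dots> = (\<Prod>e\<in>pairs n. if e \<in> D then v \<bullet> \<mu> else 1)"
    by (intro prod.cong refl) (auto simp: inner_vec_def mult.commute prob_simplexD(3)[OF \<mu>])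
  also have "\<dots> = (v \<bullet> \<mu>) ^ card D"
    unfolding restrict[symmetric] by simp
  finally show ?thesis .
qed

lemma sum_coloring_weight:
  "\<mu> \<in> prob_simplex \<Longrightarrow> (\<Sum>X\<in>colorings n. coloring_weight \<mu> n X) = 1"
  using sum_coloring_weight_prod[of \<mu> "{}" n] by simp

text \<open>Additivity of entropy for product laws: the log-weight is a sum over edges, and each
  summand has expectation \<open>neg_entropy \<mu>\<close>.\<close>

lemma coloring_weight_entropy:
  fixes \<mu> :: "real ^ 'k"
  assumes \<mu>: "\<mu> \<in> prob_simplex"
  shows "(\<Sum>X\<in>colorings n. coloring_weight \<mu> n X * ln (coloring_weight \<mu> n X))
    = real (card (pairs n)) * neg_entropy \<mu>"
proof -
  define l :: "real ^ 'k" where "l = (\<chi> a. ln (\<mu> $ a))"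
  \<comment> \<open>For a colouring of weight zero the default value of \<open>ln 0\<close> is
    harmless, because the weight is a factor on both sides.\<close>
  have "coloring_weight \<mu> n X * ln (coloring_weight \<mu> n X)
      = (\<Sum>e\<in>pairs n. coloring_weight \<mu> n X * l $ X e)" for X
  proof (cases "coloring_weight \<mu> n X = 0")
    case False
    then have "\<mu> $ X e \<noteq> 0" if "e \<in> pairs n" for e
      using that unfolding coloring_weight_def by (simp add: prod_zero_iff)
    then have "ln (coloring_weight \<mu> n X) = (\<Sum>e\<in>pairs n. l $ X e)"
      unfolding coloring_weight_def l_def by (subst ln_prod) simp_all
    then show ?thesis by (simp add: sum_distrib_left)
  qed simp
  then have "(\<Sum>X\<in>colorings n. coloring_weight \<mu> n X * ln (coloring_weight \<mu> n X))
      = (\<Sum>e\<in>pairs n. \<Sum>X\<in>colorings n. coloring_weight \<mu> n X * l $ X e)"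
    by (simp add: sum.swap[of _ "colorings n"])
  also have "\<dots> = (\<Sum>e\<in>pairs n. l \<bullet> \<mu>)"
  proof (intro sum.cong refl)
    fix e assume "e \<in> pairs n"
    then show "(\<Sum>X\<in>colorings n. coloring_weight \<mu> n X * l $ X e) = l \<bullet> \<mu>"
      using sum_coloring_weight_prod[OF \<mu>, of "{e}" n l] by simp
  qed
  also have "l \<bullet> \<mu> = neg_entropy \<mu>"
    by (simp add: l_def inner_vec_def neg_entropy_def mult.commute)
  finally show ?thesis by simp
qed

section \<open>Expected densities of empirical graphons\<close>

lemma empirical_graphon_in_prob_simplex: "empirical_graphon n X z \<in> prob_simplex"
  by (auto simp: empirical_graphon_def prob_simplex_def split: prod.splits)

lemma empirical_graphon_in_colored_graphons: "empirical_graphon n X \<in> colored_graphons"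
proof -
  let ?g = "\<lambda>(u, v). if u \<noteq> v then (\<chi> a. if X {u, v} = a then 1 else 0)
    else (\<chi> a. 1 / real CARD('a))"
  have "empirical_graphon n X = (\<lambda>z. ?g (block n (fst z), block n (snd z)))"
    by (auto simp: empirical_graphon_def)
  then have "empirical_graphon n X \<in> borel_measurable unit_square"
    using measurable_compose[OF measurable_block_pair, of ?g borel n] by simp
  then show ?thesis
    using empirical_graphon_in_prob_simplex[of n X]
    by (auto simp: colored_graphons_def) (simp add: empirical_graphon_def insert_commute)
qed

text \<open>If the vertices of \<open>H\<close> fall into distinct blocks, distinct edges of
  \<open>H\<close> read the colours of distinct edges of the complete graph, and these colours are
  independent.\<close>

lemma expected_edge_product:
  fixes \<mu> v :: "real ^ 'k"
  assumes H: "simple_graph H" and \<mu>: "\<mu> \<in> prob_simplex" and n: "n \<ge> 1"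
    and x: "\<And>u. u \<in> verts H \<Longrightarrow> x u \<in> {0..1}"
    and inj: "inj_on (\<lambda>u. block n (x u)) (verts H)"
  shows "(\<Sum>X\<in>colorings n. coloring_weight \<mu> n X
      * (\<Prod>e\<in>edges H. v \<bullet> empirical_graphon n X (x (Min e), x (Max e)))) = (v \<bullet> \<mu>) ^ card (edges H)"
proof -
  let ?b = "\<lambda>u. block n (x u)"
  let ?D = "(\<lambda>e. ?b ` e) ` edges H"
  have sub: "e \<subseteq> verts H" "card e = 2" if "e \<in> edges H" for e
    using H that by (auto simp: simple_graph_def)
  have injE: "inj_on (\<lambda>e. ?b ` e) (edges H)"
    using inj_on_image_eq_iff[OF inj] sub by (auto simp: inj_on_def)
  have D: "?D \<subseteq> pairs n"
  proof safe
    fix e u assume "e \<in> edges H" "u \<in> e"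
    then show "?b u \<in> {1..n}" using block_bounds[OF n x] sub by blast
  next
    fix e assume "e \<in> edges H"
    then show "card (?b ` e) = 2"
      using card_image[OF inj_on_subset[OF inj sub(1)]] sub(2) by simp
  qed
  have "v \<bullet> empirical_graphon n X (x (Min e), x (Max e)) = v $ X (?b ` e)" if e: "e \<in> edges H" for X e
  proof -
    note se = simple_graph_edge[OF H e]
    have "?b (Min e) \<noteq> ?b (Max e)" using inj se by (auto simp: inj_on_def)
    moreover have "?b ` e = {?b (Min e), ?b (Max e)}"
      by (subst se(3)[symmetric]) simp
    ultimately show ?thesis
      by (simp add: empirical_graphon_def inner_vec_def if_distrib sum.delta cong: if_cong)
  qed
  then have "(\<Sum>X\<in>colorings n. coloring_weight \<mu> n X
      * (\<Prod>e\<in>edges H. v \<bullet> empirical_graphon n X (x (Min e), x (Max e))))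
      = (\<Sum>X\<in>colorings n. coloring_weight \<mu> n X * (\<Prod>d\<in>?D. v $ X d))"
    by (simp add: prod.reindex[OF injE])
  also have "\<dots> = (v \<bullet> \<mu>) ^ card ?D" by (rule sum_coloring_weight_prod[OF \<mu> D])
  finally show ?thesis by (simp add: card_image[OF injE])
qed

text \<open>Points in a common block are at distance at most \<open>1 / real n\<close>, so finitely
  many distinct points are eventually separated.\<close>

lemma eventually_inj_on_block:
  assumes V: "finite V" and x: "\<And>u. u \<in> V \<Longrightarrow> x u \<in> {0..1}" and inj: "inj_on x V"
  shows "\<forall>\<^sub>F n in sequentially. inj_on (\<lambda>u. block n (x u)) V"
proof -
  have "\<forall>\<^sub>F n in sequentially. u \<noteq> v \<longrightarrow> block n (x u) \<noteq> block n (x v)" if uv: "u \<in> V" "v \<in> V" for u v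
  proof (cases "u = v")
    case False
    then have pos: "\<bar>x u - x v\<bar> > 0" using inj uv by (auto simp: inj_on_def)
    have "(\<lambda>n. 1 / real n) \<longlonglongrightarrow> 0" by (rule lim_1_over_n)
    then have "\<forall>\<^sub>F n in sequentially. 1 / real n < \<bar>x u - x v\<bar>"
      using pos by (rule order_tendstoD(2))
    then show ?thesis
      using eventually_ge_at_top[of 1]
    proof eventually_elim
      case (elim n)
      then show ?case using block_eq_imp_close[OF elim(2) x[OF uv(1)] x[OF uv(2)]] by force
    qed
  qed simp
  then have "\<forall>\<^sub>F n in sequentially. \<forall>u\<in>V. \<forall>v\<in>V. u \<noteq> v \<longrightarrow> block n (x u) \<noteq> block n (x v)"
    using V by (intro eventually_ball_finite ballI) auto
  then show ?thesis by eventually_elim (auto simp: inj_on_def)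
qed

text \<open>Almost every \<open>x\<close> has distinct coordinates; for large \<open>n\<close> these lie in distinct blocks, so that the
  factors of the product are independent under the random colouring.\<close>

lemma expected_hom_density_tendsto:
  fixes \<mu> v :: "real ^ 'k" and H :: "'v::linorder sgraph"
  assumes H: "simple_graph H" and \<mu>: "\<mu> \<in> prob_simplex"
  shows "(\<lambda>n. \<Sum>X\<in>colorings n. coloring_weight \<mu> n X
      * hom_density H (\<lambda>z. v \<bullet> empirical_graphon n X z)) \<longlonglongrightarrow> (v \<bullet> \<mu>) ^ card (edges H)"
proof -
  let ?P = "\<Pi>\<^sub>M u\<in>verts H. unit_interval"
  interpret P: prob_space ?P by (rule prob_space_PiM_unit_interval)
  define B where "B = (\<Sum>a\<in>UNIV. \<bar>v $ a\<bar>)"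
  let ?g = "\<lambda>n X x. \<Prod>e\<in>edges H. v \<bullet> empirical_graphon n X (x (Min e), x (Max e))"
  let ?h = "\<lambda>n x. \<Sum>X\<in>colorings n. coloring_weight \<mu> n X * ?g n X x"
  have meas: "?g n X \<in> borel_measurable ?P" for n and X :: "nat set \<Rightarrow> 'k"
    using colored_graphon_measurable[OF empirical_graphon_in_colored_graphons[of n X]]
    by (intro measurable_edge_product[OF H, where U = "\<lambda>z. v \<bullet> empirical_graphon n X z"]) measurable
  have bound: "\<bar>?g n X x\<bar> \<le> B ^ card (edges H)" for n x and X :: "nat set \<Rightarrow> 'k"
  proof -
    have "\<bar>?g n X x\<bar> \<le> (\<Prod>e\<in>edges H. B)"
      unfolding abs_prod B_def
      by (intro prod_mono conjI abs_ge_zero abs_inner_prob_simplex_le empirical_graphon_in_prob_simplex)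
    then show ?thesis by simp
  qed
  have int: "integrable ?P (?g n X)" for n and X :: "nat set \<Rightarrow> 'k"
    using bound meas by (intro P.integrable_const_bound[where B = "B ^ card (edges H)"]) auto
  \<comment> \<open>The index from which \<open>?h n x\<close> equals its limit depends on
    \<open>x\<close>, so dominated convergence is used. The weights sum to 1, so the bound for one
    colouring also bounds the expectation.\<close>
  have "(\<lambda>n. integral\<^sup>L ?P (?h n)) \<longlonglongrightarrow> (\<integral>x. (v \<bullet> \<mu>) ^ card (edges H) \<partial>?P)"
  proof (rule integral_dominated_convergence[where w = "\<lambda>_. B ^ card (edges H)"])
    show "?h n \<in> borel_measurable ?P" for n
      using meas by (intro borel_measurable_sum borel_measurable_times) auto
    show "AE x in ?P. norm (?h n x) \<le> B ^ card (edges H)" for n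
    proof (rule AE_I2)
      fix x
      have "\<bar>?h n x\<bar> \<le> (\<Sum>X\<in>colorings n. \<bar>coloring_weight \<mu> n X * ?g n X x\<bar>)"
        by (rule sum_abs)
      also have "\<dots> \<le> (\<Sum>X\<in>colorings n. coloring_weight \<mu> n X * B ^ card (edges H))"
        unfolding abs_mult abs_of_nonneg[OF coloring_weight_nonneg[OF \<mu>]]
        by (intro sum_mono mult_left_mono bound coloring_weight_nonneg[OF \<mu>])
      also have "\<dots> = B ^ card (edges H)"
        by (simp add: sum_distrib_right[symmetric] sum_coloring_weight[OF \<mu>])
      finally show "norm (?h n x) \<le> B ^ card (edges H)" by simp
    qed
    have "AE x in ?P. x \<in> space ?P" by simp
    moreover have fin: "finite (verts H)" using H by (simp add: simple_graph_def)
    note AE_PiM_inj_on[OF fin]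
    ultimately show "AE x in ?P. (\<lambda>n. ?h n x) \<longlonglongrightarrow> (v \<bullet> \<mu>) ^ card (edges H)"
    proof eventually_elim
      case (elim x)
      then have x: "x u \<in> {0..1}" if "u \<in> verts H" for u
        using that by (auto simp: space_PiM PiE_iff)
      have "\<forall>\<^sub>F n in sequentially. inj_on (\<lambda>u. block n (x u)) (verts H)"
        by (rule eventually_inj_on_block[OF fin _ elim(2)]) (rule x)
      then have "\<forall>\<^sub>F n in sequentially. ?h n x = (v \<bullet> \<mu>) ^ card (edges H)"
        using eventually_ge_at_top[of 1]
      proof eventually_elim
        case (elim n)
        show ?case by (rule expected_edge_product[OF H \<mu> elim(2) x elim(1)])
      qed
      then show ?case by (rule tendsto_eventually)
    qed
  qed auto
  moreover have "integral\<^sup>L ?P (?h n) = (\<Sum>X\<in>colorings n. coloring_weight \<mu> n X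
      * hom_density H (\<lambda>z. v \<bullet> empirical_graphon n X z))" for n
    using int by (simp add: hom_density_def)
  ultimately show ?thesis by (simp add: P.prob_space)
qed


section \<open>The lower bound for the free energy\<close>

lemma card_pairs: "2 * real (card (pairs n)) = real n * (real n - 1)"
proof -
  have "2 * real (card (pairs n)) = (\<Sum>u\<in>{1..n}. \<Sum>v\<in>{1..n}. if u \<noteq> v then 1 else 0)"
    using sum_ordered_pairs[of "{1..n}" "\<lambda>_. 1"] by simp
  also have "\<dots> = (\<Sum>u\<in>{1..n}. real n - 1)"
  proof (intro sum.cong refl)
    fix u assume u: "u \<in> {1..n}"
    have "(\<Sum>v\<in>{1..n}. if u \<noteq> v then 1 else 0) = (\<Sum>v\<in>{1..n}. 1 - (if u = v then 1 else (0::real)))"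
      by (intro sum.cong) auto
    also have "\<dots> = real n - 1" using u by (simp add: sum_subtractf)
    finally show "(\<Sum>v\<in>{1..n}. if u \<noteq> v then 1 else (0::real)) = real n - 1" .
  qed
  finally show ?thesis by simp
qed

text \<open>This density of unordered pairs is the origin of the factor \<open>1 / 2\<close> in
  front of the entropy.\<close>

lemma card_pairs_density_tendsto: "(\<lambda>n. real (card (pairs n)) / (real n)\<^sup>2) \<longlonglongrightarrow> 1 / 2"
proof -
  have "real (card (pairs n)) = real n * (real n - 1) / 2" for n
    using card_pairs[of n] by simp
  then have "(\<lambda>n. real (card (pairs n)) / (real n)\<^sup>2) = (\<lambda>n. real n * (real n - 1) / 2 / (real n)\<^sup>2)"
    by (simp only:)
  then show ?thesis by (simp only:) real_asymp
qed

text \<open>The Gibbs inequality for the law \<open>coloring_weight \<mu> n\<close> and the energy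
  \<open>n\<^sup>2 * T\<close>, divided by \<open>n\<^sup>2\<close>.\<close>

lemma free_energy_lower_bound:
  fixes \<mu> :: "real ^ 'k"
  assumes \<mu>: "\<mu> \<in> prob_simplex" and n: "n \<ge> 1"
  shows "(\<Sum>X\<in>colorings n. coloring_weight \<mu> n X * T (empirical_graphon n X))
      - real (card (pairs n)) / (real n)\<^sup>2 * neg_entropy \<mu> \<le> free_energy T n"
proof -
  let ?w = "coloring_weight \<mu> n"
  have "(\<Sum>X\<in>colorings n. ?w X * ((real n)\<^sup>2 * T (empirical_graphon n X)) - ?w X * ln (?w X))
      \<le> ln (\<Sum>X\<in>colorings n. exp ((real n)\<^sup>2 * T (empirical_graphon n X)))"
    by (intro gibbs_variational finite_colorings coloring_weight_nonneg[OF \<mu>] sum_coloring_weight[OF \<mu>])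
  also have "(\<Sum>X\<in>colorings n. ?w X * ((real n)\<^sup>2 * T (empirical_graphon n X)) - ?w X * ln (?w X))
      = (real n)\<^sup>2 * ((\<Sum>X\<in>colorings n. ?w X * T (empirical_graphon n X))
        - real (card (pairs n)) / (real n)\<^sup>2 * neg_entropy \<mu>)"
    using n by (simp add: sum_subtractf coloring_weight_entropy[OF \<mu>] sum_distrib_left
        right_diff_distrib mult.left_commute)
  finally show ?thesis
    using n by (simp add: free_energy_def pos_le_divide_eq mult.commute)
qed

text \<open>Linearity of expectation reduces this to the single densities. The limit is the value of
  \<open>T\<close> at the constant graphon \<open>\<mu>\<close>.\<close>

lemma expected_T_functional_tendsto:
  fixes \<mu> :: "real ^ 'k"
  assumes F: "\<And>s. s \<in> {1..R} \<Longrightarrow> simple_graph (F s)" and \<mu>: "\<mu> \<in> prob_simplex"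
  shows "(\<lambda>n. \<Sum>X\<in>colorings n. coloring_weight \<mu> n X
      * T_functional R F \<eta> \<delta> c (empirical_graphon n X))
    \<longlonglongrightarrow> scalar_objective R F \<eta> \<delta> c \<mu> + 1 / 2 * neg_entropy \<mu>"
proof -
  let ?E = "\<lambda>f n. \<Sum>X\<in>colorings n. coloring_weight \<mu> n X * f n X"
  have "(\<lambda>n. ?E (\<lambda>n X. hom_density K2 (\<lambda>z. c \<bullet> empirical_graphon n X z)) n
      - (\<Sum>s=1..R. \<delta> s * ?E (\<lambda>n X. hom_density (F s) (\<lambda>z. \<eta> s \<bullet> empirical_graphon n X z)) n))
    \<longlonglongrightarrow> (c \<bullet> \<mu>) ^ card (edges K2) - (\<Sum>s=1..R. \<delta> s * (\<eta> s \<bullet> \<mu>) ^ card (edges (F s)))"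
    by (intro tendsto_diff tendsto_sum tendsto_mult tendsto_const
        expected_hom_density_tendsto[OF _ \<mu>] simple_graph_K2 F)
  moreover have "?E (\<lambda>n X. hom_density K2 (\<lambda>z. c \<bullet> empirical_graphon n X z)) n
      - (\<Sum>s=1..R. \<delta> s * ?E (\<lambda>n X. hom_density (F s) (\<lambda>z. \<eta> s \<bullet> empirical_graphon n X z)) n)
    = ?E (\<lambda>n X. T_functional R F \<eta> \<delta> c (empirical_graphon n X)) n" for n
  proof -
    have "(\<Sum>s=1..R. \<delta> s * ?E (\<lambda>n X. hom_density (F s) (\<lambda>z. \<eta> s \<bullet> empirical_graphon n X z)) n)
      = ?E (\<lambda>n X. \<Sum>s=1..R. \<delta> s * hom_density (F s) (\<lambda>z. \<eta> s \<bullet> empirical_graphon n X z)) n"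
      unfolding sum_distrib_left by (subst sum.swap) (simp add: mult.left_commute)
    then show ?thesis
      by (simp add: T_functional_def right_diff_distrib sum_subtractf)
  qed
  ultimately show ?thesis by (simp add: scalar_objective_def K2_def)
qed

section \<open>The upper bound: counting colourings by their mean\<close>

lemma mean_empirical_graphon:
  fixes X :: "nat set \<Rightarrow> 'k::finite"
  assumes "n \<ge> 1"
  shows "(integral\<^sup>L unit_square (empirical_graphon n X)) $ a
    = (\<Sum>u\<in>{1..n}. \<Sum>v\<in>{1..n}. if u \<noteq> v then (if X {u, v} = a then 1 else 0) else 1 / real CARD('k))
      / (real n)\<^sup>2"
proof -
  have "(integral\<^sup>L unit_square (empirical_graphon n X)) $ a
      = (\<integral>z. empirical_graphon n X z $ a \<partial>unit_square)"
    by (rule integrable_colored_graphon_nth(2)[symmetric, OF empirical_graphon_in_colored_graphons])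
  also have "\<dots> = (\<integral>z. (\<lambda>u v. if u \<noteq> v then (if X {u, v} = a then 1 else 0) else 1 / real CARD('k))
      (block n (fst z)) (block n (snd z)) \<partial>unit_square)"
    by (intro Bochner_Integration.integral_cong) (auto simp: empirical_graphon_def)
  also note integral_block_pair[OF assms]
  finally show ?thesis .
qed

text \<open>The diagonal blocks only lower the entropy sum, because \<open>ln (m $ a) \<le> 0\<close>.\<close>

lemma coloring_weight_mean_ge:
  fixes X :: "nat set \<Rightarrow> 'k::finite"
  assumes n: "n \<ge> 1"
  defines "m \<equiv> integral\<^sup>L unit_square (empirical_graphon n X)"
  shows "exp ((real n)\<^sup>2 / 2 * neg_entropy m) \<le> coloring_weight m n X"
proof -
  let ?w = "\<lambda>a u v. if u \<noteq> v then (if X {u, v} = a then 1 else 0) else 1 / real CARD('k)"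
  have m: "m \<in> prob_simplex"
    unfolding m_def by (rule mean_in_prob_simplex[OF empirical_graphon_in_colored_graphons])
  have mean: "(real n)\<^sup>2 * m $ a = (\<Sum>u\<in>{1..n}. \<Sum>v\<in>{1..n}. ?w a u v)" for a
    using n by (simp add: m_def mean_empirical_graphon)
  \<comment> \<open>The diagonal block \<open>(1, 1)\<close> contributes \<open>1 / CARD('k)\<close>
    to every colour, including colours that \<open>X\<close> does not use, so all logarithms below
    are genuine.\<close>
  have pos: "m $ a > 0" for a
  proof -
    have "0 < (\<Sum>v\<in>{1..n}. ?w a 1 v)"
      using n by (intro sum_pos2[of _ 1]) auto
    then have "0 < (\<Sum>u\<in>{1..n}. \<Sum>v\<in>{1..n}. ?w a u v)"
      using n by (intro sum_pos2[of _ 1]) (auto intro!: sum_nonneg)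
    then have "0 < (real n)\<^sup>2 * m $ a" unfolding mean .
    then show ?thesis by (simp add: zero_less_mult_iff)
  qed
  have "(real n)\<^sup>2 * neg_entropy m = (\<Sum>a\<in>UNIV. ((real n)\<^sup>2 * m $ a) * ln (m $ a))"
    by (simp add: neg_entropy_def sum_distrib_left mult.assoc)
  also have "\<dots> = (\<Sum>a\<in>UNIV. \<Sum>u\<in>{1..n}. \<Sum>v\<in>{1..n}. ?w a u v * ln (m $ a))"
    unfolding mean by (simp only: sum_distrib_right)
  also have "\<dots> = (\<Sum>u\<in>{1..n}. \<Sum>v\<in>{1..n}. \<Sum>a\<in>UNIV. ?w a u v * ln (m $ a))"
    by (subst sum.swap, rule sum.cong[OF refl], rule sum.swap)
  also have "\<dots> \<le> (\<Sum>u\<in>{1..n}. \<Sum>v\<in>{1..n}. if u \<noteq> v then ln (m $ X {u, v}) else 0)"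
  proof (intro sum_mono)
    fix u v
    have "(\<Sum>a\<in>UNIV. ?w a u v * ln (m $ a)) = ln (m $ X {u, v})" if "u \<noteq> v"
    proof -
      have "(\<Sum>a\<in>UNIV. ?w a u v * ln (m $ a)) = (\<Sum>a\<in>UNIV. if X {u, v} = a then ln (m $ a) else 0)"
        using that by (intro sum.cong) auto
      then show ?thesis by simp
    qed
    moreover have "(\<Sum>a\<in>UNIV. 1 / real CARD('k) * ln (m $ a)) \<le> 0"
      using pos prob_simplexD(2)[OF m] by (intro sum_nonpos mult_nonneg_nonpos) auto
    ultimately show "(\<Sum>a\<in>UNIV. ?w a u v * ln (m $ a)) \<le> (if u \<noteq> v then ln (m $ X {u, v}) else 0)"
      by (cases "u = v") auto
  qed
  \<comment> \<open>Each edge occupies two blocks of the square; this accounts for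
    \<open>n\<^sup>2 / 2\<close> in the exponent.\<close>
  also have "\<dots> = 2 * (\<Sum>e\<in>pairs n. ln (m $ X e))"
    by (rule sum_ordered_pairs) simp
  also have "(\<Sum>e\<in>pairs n. ln (m $ X e)) = ln (coloring_weight m n X)"
    unfolding coloring_weight_def using pos by (intro ln_prod[symmetric]) (auto simp: less_imp_neq[symmetric])
  finally have "(real n)\<^sup>2 / 2 * neg_entropy m \<le> ln (coloring_weight m n X)" by simp
  moreover have "coloring_weight m n X > 0"
    unfolding coloring_weight_def using pos by (intro prod_pos) auto
  ultimately show ?thesis by (metis exp_le_cancel_iff exp_ln)
qed

text \<open>The method of types: under the product law of \<open>\<nu>\<close> each member of the
  fibre has at least the stated exponential as its probability, and the probabilities sum to at most
  1.\<close>

lemma card_mean_fiber_le: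
  fixes \<nu> :: "real ^ 'k"
  assumes n: "n \<ge> 1"
  defines "A \<equiv> {X \<in> colorings n. integral\<^sup>L unit_square (empirical_graphon n X) = \<nu>}"
  shows "real (card A) * exp ((real n)\<^sup>2 / 2 * neg_entropy \<nu>) \<le> 1"
proof (cases "A = {}")
  case False
  then have \<nu>: "\<nu> \<in> prob_simplex"
    using mean_in_prob_simplex[OF empirical_graphon_in_colored_graphons[of n]] by (auto simp: A_def)
  have "real (card A) * exp ((real n)\<^sup>2 / 2 * neg_entropy \<nu>)
      = (\<Sum>X\<in>A. exp ((real n)\<^sup>2 / 2 * neg_entropy \<nu>))" by simp
  also have "\<dots> \<le> (\<Sum>X\<in>A. coloring_weight \<nu> n X)"
    using coloring_weight_mean_ge[OF n] by (intro sum_mono) (auto simp: A_def)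
  also have "\<dots> \<le> (\<Sum>X\<in>colorings n. coloring_weight \<nu> n X)"
    by (intro sum_mono2) (auto simp: A_def coloring_weight_nonneg[OF \<nu>])
  finally show ?thesis by (simp add: sum_coloring_weight[OF \<nu>])
qed simp

text \<open>The mean is determined by how many edges carry each colour, and each of these counts
  lies between 0 and \<open>n\<^sup>2\<close>.\<close>

lemma card_means_le:
  assumes n: "n \<ge> 1"
  shows "card ((\<lambda>X :: nat set \<Rightarrow> 'k::finite. integral\<^sup>L unit_square (empirical_graphon n X)) ` colorings n)
    \<le> (n\<^sup>2 + 1) ^ CARD('k)"
proof -
  let ?mean = "\<lambda>X :: nat set \<Rightarrow> 'k. integral\<^sup>L unit_square (empirical_graphon n X)"
  define N where "N X a = card {e \<in> pairs n. X e = a}" for X :: "nat set \<Rightarrow> 'k" and a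
  \<comment> \<open>An edge of colour \<open>a\<close> fills two blocks, and the \<open>n\<close>
    diagonal blocks contribute \<open>1 / CARD('k)\<close> each.\<close>
  define \<Phi> :: "('k \<Rightarrow> nat) \<Rightarrow> real ^ 'k"
    where "\<Phi> f = (\<chi> a. (2 * real (f a) + real n / real CARD('k)) / (real n)\<^sup>2)" for f
  have "?mean X = \<Phi> (N X)" for X
  proof -
    have "(\<Sum>u\<in>{1..n}. \<Sum>v\<in>{1..n}. if u \<noteq> v then (if X {u, v} = a then 1 else 0) else 1 / real CARD('k))
        = 2 * real (N X a) + real n / real CARD('k)" for a
    proof -
      have "(\<Sum>u\<in>{1..n}. \<Sum>v\<in>{1..n}. if u \<noteq> v then (if X {u, v} = a then 1 else 0) else 1 / real CARD('k))
        = (\<Sum>u\<in>{1..n}. \<Sum>v\<in>{1..n}. (if u \<noteq> v then (if X {u, v} = a then 1 else 0) else 0)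
            + (if u = v then 1 / real CARD('k) else 0))"
        by (intro sum.cong refl) auto
      also have "\<dots> = 2 * (\<Sum>e\<in>pairs n. if X e = a then 1 else 0) + real n / real CARD('k)"
        unfolding sum.distrib
        by (subst sum_ordered_pairs[of "{1..n}" "\<lambda>e. if X e = a then 1 else 0"]) simp_all
      also have "(\<Sum>e\<in>pairs n. if X e = a then 1 else 0) = real (N X a)"
        by (subst sum.inter_filter[symmetric]) (simp_all add: N_def)
      finally show ?thesis .
    qed
    then show ?thesis by (simp add: vec_eq_iff \<Phi>_def mean_empirical_graphon[OF n])
  qed
  moreover have "N X \<in> UNIV \<rightarrow>\<^sub>E {..n\<^sup>2}" for X
  proof -
    have "N X a \<le> n\<^sup>2" for a
    proof -
      have "N X a \<le> card (pairs n)" unfolding N_def by (intro card_mono) auto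
      moreover have "2 * real (card (pairs n)) \<le> 2 * real (n\<^sup>2)"
        unfolding card_pairs using n by (simp add: power2_eq_square algebra_simps)
      ultimately show ?thesis by linarith
    qed
    then show ?thesis by auto
  qed
  ultimately have "?mean ` colorings n \<subseteq> \<Phi> ` (UNIV \<rightarrow>\<^sub>E {..n\<^sup>2})" by auto
  then have "card (?mean ` colorings n) \<le> card (\<Phi> ` (UNIV \<rightarrow>\<^sub>E {..n\<^sup>2}))"
    by (intro card_mono finite_imageI finite_PiE) auto
  also have "\<dots> \<le> card ((UNIV :: 'k set) \<rightarrow>\<^sub>E {..n\<^sup>2})"
    by (intro card_image_le finite_PiE) auto
  also have "\<dots> = (n\<^sup>2 + 1) ^ CARD('k)" by (simp add: card_PiE)
  finally show ?thesis .
qed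

text \<open>On the colourings with a given mean, the entropy factor in the energy bound is offset by
  their number, so each mean contributes at most \<open>exp (n\<^sup>2 * S)\<close>. The polynomial
  number of means leaves an error of order \<open>ln n / n\<^sup>2\<close>.\<close>

lemma free_energy_upper_bound:
  fixes T :: "(real \<times> real \<Rightarrow> real ^ 'k) \<Rightarrow> real"
  assumes n: "n \<ge> 1"
    and T: "\<And>X. T (empirical_graphon n X)
        \<le> S + 1 / 2 * neg_entropy (integral\<^sup>L unit_square (empirical_graphon n X))"
  shows "free_energy T n \<le> S + real CARD('k) * ln ((real n)\<^sup>2 + 1) / (real n)\<^sup>2"
proof -
  let ?mean = "\<lambda>X :: nat set \<Rightarrow> 'k. integral\<^sup>L unit_square (empirical_graphon n X)"
  let ?A = "\<lambda>\<nu>. {X \<in> colorings n. ?mean X = \<nu>}"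
  let ?Z = "\<Sum>X\<in>colorings n. exp ((real n)\<^sup>2 * T (empirical_graphon n X))"
  have "?Z \<le> (\<Sum>X\<in>colorings n. exp ((real n)\<^sup>2 * (S + 1 / 2 * neg_entropy (?mean X))))"
    by (intro sum_mono) (use T in \<open>auto intro!: mult_left_mono\<close>)
  also have "\<dots> = (\<Sum>\<nu>\<in>?mean ` colorings n. \<Sum>X\<in>?A \<nu>.
      exp ((real n)\<^sup>2 * (S + 1 / 2 * neg_entropy (?mean X))))"
    by (rule sum.image_gen) simp
  also have "\<dots> = (\<Sum>\<nu>\<in>?mean ` colorings n.
      exp ((real n)\<^sup>2 * S) * (real (card (?A \<nu>)) * exp ((real n)\<^sup>2 / 2 * neg_entropy \<nu>)))"
    by (intro sum.cong refl) (simp add: distrib_left exp_add)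
  also have "\<dots> \<le> (\<Sum>\<nu>\<in>?mean ` colorings n. exp ((real n)\<^sup>2 * S) * 1)"
    by (intro sum_mono mult_left_mono card_mean_fiber_le[OF n]) simp
  also have "\<dots> = real (card (?mean ` colorings n)) * exp ((real n)\<^sup>2 * S)" by simp
  also have "\<dots> \<le> real ((n\<^sup>2 + 1) ^ CARD('k)) * exp ((real n)\<^sup>2 * S)"
    by (intro mult_right_mono of_nat_mono card_means_le[OF n]) simp
  finally have Z: "?Z \<le> ((real n)\<^sup>2 + 1) ^ CARD('k) * exp ((real n)\<^sup>2 * S)"
    by (simp add: add.commute)
  have "colorings n \<noteq> ({} :: (nat set \<Rightarrow> 'k) set)" by (simp add: colorings_def PiE_eq_empty_iff)
  then have "?Z > 0" by (intro sum_pos) auto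
  then have "ln ?Z \<le> ln (((real n)\<^sup>2 + 1) ^ CARD('k) * exp ((real n)\<^sup>2 * S))"
    using Z by (intro ln_mono) auto
  also have "\<dots> = real CARD('k) * ln ((real n)\<^sup>2 + 1) + (real n)\<^sup>2 * S"
    using add_nonneg_pos[of "(real n)\<^sup>2" 1] by (simp add: ln_mult ln_realpow)
  finally have "1 / (real n)\<^sup>2 * ln ?Z
      \<le> 1 / (real n)\<^sup>2 * (real CARD('k) * ln ((real n)\<^sup>2 + 1) + (real n)\<^sup>2 * S)"
    by (rule mult_left_mono) simp
  also have "\<dots> = S + real CARD('k) * ln ((real n)\<^sup>2 + 1) / (real n)\<^sup>2"
    using n by (simp add: field_simps)
  finally show ?thesis by (simp add: free_energy_def)
qed

section \<open>The limit of the free energy and the structure of maximizers\<close>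

theorem theorem3p15:
  fixes R :: nat
    and F :: "nat \<Rightarrow> 'v::linorder sgraph"
    and \<eta> :: "nat \<Rightarrow> real ^ 'k"
    and \<delta> :: "nat \<Rightarrow> real"
    and c1 :: "real ^ 'k"
  assumes "CARD('k) \<ge> 2"
    and "\<And>s. s \<in> {1..R} \<Longrightarrow> sidorenko_graph (F s)"
    and "\<And>s. s \<in> {1..R} \<Longrightarrow> card (edges (F s)) \<ge> 1"
    and "\<And>s a. s \<in> {1..R} \<Longrightarrow> \<eta> s $ a \<ge> 0"
    and "\<And>s. s \<in> {1..R} \<Longrightarrow> \<delta> s \<ge> 0"
  shows "(\<lambda>n. free_energy (T_functional R F \<eta> \<delta> c1) n) \<longlonglongrightarrow>
           (SUP \<mu>\<in>prob_simplex. scalar_objective R F \<eta> \<delta> c1 \<mu>)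
       \<and> (\<forall>W\<in>colored_graphons.
           (\<forall>W'\<in>colored_graphons.
              T_functional R F \<eta> \<delta> c1 W' - 1 / 2 * graphon_neg_entropy W'
                \<le> T_functional R F \<eta> \<delta> c1 W - 1 / 2 * graphon_neg_entropy W) \<longrightarrow>
           (\<exists>\<mu>\<in>prob_simplex. (AE z in unit_square. W z = \<mu>) \<and>
              scalar_objective R F \<eta> \<delta> c1 \<mu>
                = (SUP \<nu>\<in>prob_simplex. scalar_objective R F \<eta> \<delta> c1 \<nu>)))"
proof (intro conjI ballI impI)
  let ?T = "T_functional R F \<eta> \<delta> c1"
  let ?L = "scalar_objective R F \<eta> \<delta> c1"
  let ?S = "SUP \<mu>\<in>prob_simplex. ?L \<mu>"
  have T_le: "?T W \<le> ?L (integral\<^sup>L unit_square W) + 1 / 2 * neg_entropy (integral\<^sup>L unit_square W)"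
    if "W \<in> colored_graphons" for W
    by (rule T_functional_le_scalar[OF assms(2-5) that])
  have bdd: "bdd_above (?L ` prob_simplex)"
    by (rule bdd_above_scalar_objective[OF assms(4,5)])
  have "(\<chi> a. 1 / real CARD('k)) \<in> (prob_simplex :: (real ^ 'k) set)"
    by (simp add: prob_simplex_def)
  then have ne: "(prob_simplex :: (real ^ 'k) set) \<noteq> {}" by auto
  show "free_energy ?T \<longlonglongrightarrow> ?S"
  \<comment> \<open>A level below the supremum is exceeded at some fixed \<open>\<mu>\<close>, to
    which the lower bound applies; for a level above it, the polynomial correction in the upper
    bound tends to 0.\<close>
  proof (rule order_tendstoI)
    fix a assume "a < ?S"
    then obtain \<mu> where \<mu>: "\<mu> \<in> prob_simplex" "a < ?L \<mu>"
      using less_cSUP_iff[OF ne bdd] by auto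
    have sg: "simple_graph (F s)" if "s \<in> {1..R}" for s
      using assms(2)[OF that] by (simp add: sidorenko_graph_def)
    let ?l = "\<lambda>n. (\<Sum>X\<in>colorings n. coloring_weight \<mu> n X * ?T (empirical_graphon n X))
      - real (card (pairs n)) / (real n)\<^sup>2 * neg_entropy \<mu>"
    have "?l \<longlonglongrightarrow> ?L \<mu> + 1 / 2 * neg_entropy \<mu> - 1 / 2 * neg_entropy \<mu>"
      by (intro tendsto_diff tendsto_mult tendsto_const card_pairs_density_tendsto
          expected_T_functional_tendsto \<mu>(1) sg)
    then have "\<forall>\<^sub>F n in sequentially. a < ?l n"
      using \<mu>(2) by (intro order_tendstoD(1)) auto
    then show "\<forall>\<^sub>F n in sequentially. a < free_energy ?T n"
      using eventually_ge_at_top[of 1]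
    proof eventually_elim
      case (elim n)
      show ?case using elim(1) free_energy_lower_bound[OF \<mu>(1) elim(2), of ?T] by (rule less_le_trans)
    qed
  next
    fix a assume a: "?S < a"
    have "(\<lambda>n. ?S + real CARD('k) * ln ((real n)\<^sup>2 + 1) / (real n)\<^sup>2) \<longlonglongrightarrow> ?S + 0"
      by (intro tendsto_add tendsto_const) real_asymp
    then have "\<forall>\<^sub>F n in sequentially. ?S + real CARD('k) * ln ((real n)\<^sup>2 + 1) / (real n)\<^sup>2 < a"
      using a by (intro order_tendstoD(2)) auto
    then show "\<forall>\<^sub>F n in sequentially. free_energy ?T n < a"
      using eventually_ge_at_top[of 1]
    proof eventually_elim
      case (elim n)
      have "?T (empirical_graphon n X)
          \<le> ?S + 1 / 2 * neg_entropy (integral\<^sup>L unit_square (empirical_graphon n X))" for X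
        using T_le[OF empirical_graphon_in_colored_graphons[of n X]]
          cSUP_upper[OF mean_in_prob_simplex[OF empirical_graphon_in_colored_graphons[of n X]] bdd]
        by linarith
      from free_energy_upper_bound[OF elim(2) this] elim(1) show ?case by (rule le_less_trans)
    qed
  qed
next
  let ?T = "T_functional R F \<eta> \<delta> c1"
  let ?L = "scalar_objective R F \<eta> \<delta> c1"
  fix W assume W: "W \<in> colored_graphons"
    and "\<forall>W'\<in>colored_graphons.
      ?T W' - 1 / 2 * graphon_neg_entropy W' \<le> ?T W - 1 / 2 * graphon_neg_entropy W"
  \<comment> \<open>Constant graphons serve as competitors, which links the maximizer to the scalar
    problem.\<close>
  then have max: "?L \<nu> \<le> ?T W - 1 / 2 * graphon_neg_entropy W" if "\<nu> \<in> prob_simplex" for \<nu>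
    using const_in_colored_graphons[OF that]
    by (force simp: T_functional_const graphon_neg_entropy_const)
  define m where "m = integral\<^sup>L unit_square W"
  have m: "m \<in> prob_simplex" unfolding m_def by (rule mean_in_prob_simplex[OF W])
  have T_le: "?T W \<le> ?L m + 1 / 2 * neg_entropy m"
    unfolding m_def by (rule T_functional_le_scalar[OF assms(2-5) W])
  \<comment> \<open>Comparison with the constant graphon \<open>m\<close> yields the reverse of
    Jensen's inequality, so equality must hold.\<close>
  have "graphon_neg_entropy W \<le> neg_entropy m"
    using max[OF m] T_le by linarith
  from jensen_neg_entropy_eq[OF W this[unfolded m_def]]
  have AE: "AE z in unit_square. W z = m" unfolding m_def .
  have "graphon_neg_entropy W = graphon_neg_entropy (\<lambda>z. m)"
    unfolding graphon_neg_entropy_def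
  proof (rule integral_cong_AE)
    show "(\<lambda>z. neg_entropy (W z)) \<in> borel_measurable unit_square"
      unfolding neg_entropy_def
      using borel_measurable_integrable[OF integrable_colored_graphon_nth(1)[OF W]]
      by (intro borel_measurable_sum borel_measurable_times) auto
  qed (use AE in auto)
  then have "graphon_neg_entropy W = neg_entropy m"
    by (simp add: graphon_neg_entropy_const)
  \<comment> \<open>Once the two entropies agree, the upper bound on \<open>?T W\<close> becomes
    \<open>?L m\<close> after subtracting the entropy, so \<open>m\<close> dominates every
    competitor.\<close>
  then have "?L \<nu> \<le> ?L m" if "\<nu> \<in> prob_simplex" for \<nu>
    using max[OF that] T_le by linarith
  then have "?L m = (SUP \<nu>\<in>prob_simplex. ?L \<nu>)"
    using m by (intro cSup_eq_maximum[symmetric]) auto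
  then show "\<exists>\<mu>\<in>prob_simplex. (AE z in unit_square. W z = \<mu>) \<and> ?L \<mu> = (SUP \<nu>\<in>prob_simplex. ?L \<nu>)"
    using m AE by blast
qed

end
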